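(* Let $\mathcal{I}$ be either the $\sigma$-ideal $\mathcal{N}$ of Lebesgue null subsets of $\mathbb{R}$ or the $\sigma$-ideal $\mathcal{M}$ of meager subsets of $\mathbb{R}$. Then for every set $X\subseteq\mathbb{R}$ there exist sets $X_1, X_2\subseteq X$ such that $X_1\cup X_2=X$, $X_1\cap X_2=\emptyset$, and both $X_1$ and $X_2$ are full in $X$ with respect to $\mathcal{I}$.
   Context: Let $\mathcal{B}$ denote the $\sigma$-algebra of Borel subsets of $\mathbb{R}$. For a $\sigma$-ideal $\mathcal{I}$ of subsets of $\mathbb{R}$, a set $M\subseteq\mathbb{R}$ is called $\mathcal{I}$-measurable if it belongs to $\sigma(\mathcal{B}\cup\mathcal{I})$, the $\sigma$-algebra generated by the Borel sets and $\mathcal{I}$. A set $A\subseteq B$ is full in $B$ with respect to $\mathcal{I}$ if for each $\mathcal{I}$-measurable set $M$ we have $M\cap A\in\mathcal{I}\Leftrightarrow M\cap B\in\mathcal{I}$. *)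

theory Defs
  imports "HOL-Analysis.Analysis"
begin

definition nowhere_dense :: "'a::topological_space set \<Rightarrow> bool" where
  "nowhere_dense A \<longleftrightarrow> interior (closure A) = {}"

definition meager :: "'a::topological_space set \<Rightarrow> bool" where
  "meager S \<longleftrightarrow> (\<exists>A :: nat \<Rightarrow> 'a set. (\<forall>n. nowhere_dense (A n)) \<and> S = (\<Union>n. A n))"

definition null_ideal :: "real set set" where
  "null_ideal = null_sets lebesgue"

definition meager_ideal :: "real set set" where
  "meager_ideal = {S. meager S}"

definition ideal_measurable :: "real set set \<Rightarrow> real set \<Rightarrow> bool" where
  "ideal_measurable I M \<longleftrightarrow> M \<in> sigma_sets UNIV (sets borel \<union> I)"

definition full_in :: "real set set \<Rightarrow> real set \<Rightarrow> real set \<Rightarrow> bool" where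
  "full_in I A B \<longleftrightarrow>
     A \<subseteq> B \<and> (\<forall>M. ideal_measurable I M \<longrightarrow> (M \<inter> A \<in> I \<longleftrightarrow> M \<inter> B \<in> I))"

end

theory Submission
  imports Defs
begin

text \<open>
  Null sets and meager sets share a countability property, here called exhaustion: every family
  of measurable sets has a countable subfamily whose union contains each member up to a set of the
  ideal. Exhaustion provides measurable hulls, and it reduces the theorem to a local one. Choose
  countably many measurable pieces on which \<open>X\<close> can be divided into two full parts, such that
  every other such piece is covered by them modulo the ideal; gluing the parts divides \<open>X\<close> over
  the union \<open>U\<close> of the pieces. For \<open>A \<subseteq> X - U\<close>, over the intersection of the hulls of \<open>A\<close> and of \<open>(X - U) - A\<close>,
  the set \<open>A\<close> divides \<open>X\<close>, so this intersection is already covered by \<open>U\<close>. Hence every subset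
  of \<open>X - U\<close> is the trace of a measurable set on \<open>X - U\<close>.

  It remains to see that such a remainder lies in the ideal (then it can be given to either part).
  If it does not, well-order the line and cut the remainder at the first initial segment outside
  the ideal (or do not cut). This gives a set \<open>Y\<close> outside the ideal with a strict well-order
  whose proper initial segments all lie in the ideal. The order relation on \<open>Y \<times> Y\<close> then has
  sections in the ideal in one direction and sections with complement in the ideal in the other,
  as in Sierpinski's paradoxical subset of the plane. A Fubini theorem would refute this if the
  relation were measurable in the plane.
  The relation itself need not be, but it can be replaced by one that is. Each
  initial segment below \<open>y\<close> is covered by a simple set \<open>D y\<close> (an open set of small measure, or a
  countable union of nowhere dense sets), and \<open>D y\<close> is coded by the basic open sets \<open>B\<close> contained
  in an open set or missing a nowhere dense one. For each of the countably many \<open>B\<close>, the set of those \<open>y\<close> whose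
  code contains \<open>B\<close> is a subset of \<open>Y\<close>, hence the trace of a measurable set. So the
  relation \<open>x \<in> D y\<close> is, on \<open>Y\<close>, the trace of a set built from countably many measurable
  rectangles. Tonelli's theorem finishes the argument for measure
  (\<open>no_sierpinski_relation_null\<close>), and the argument of Kuratowski and Ulam for category
  (\<open>no_sierpinski_relation_meager\<close>).
\<close>

section \<open>Sigma-ideals admitting exhaustion\<close>

definition all_subsets_measurable_in :: "real set set \<Rightarrow> real set \<Rightarrow> bool" where
  "all_subsets_measurable_in I Y \<longleftrightarrow> (\<forall>A\<subseteq>Y. \<exists>M. ideal_measurable I M \<and> A = M \<inter> Y)"

text \<open>
  The sections are those of Sierpinski's subset of the plane: \<open>r\<close> looks negligible
  when sliced horizontally and co-negligible when sliced vertically.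
\<close>

definition sierpinski_relation :: "real set set \<Rightarrow> real set \<Rightarrow> (real \<Rightarrow> real \<Rightarrow> bool) \<Rightarrow> bool" where
  "sierpinski_relation I Y r \<longleftrightarrow>
     (\<forall>y\<in>Y. {x\<in>Y. r x y} \<in> I) \<and> (\<forall>x\<in>Y. {y\<in>Y. \<not> r x y} \<in> I)"

text \<open>
  The localised form of the goal: inside \<open>M\<close>, both \<open>A\<close> and \<open>X - A\<close> are full in \<open>X\<close>.
  Quantifying over the measurable subsets of \<open>M\<close> makes the property survive shrinking \<open>M\<close>, so
  that pieces can be made disjoint before they are glued. The set \<open>A\<close> may stick out of \<open>M\<close>.
\<close>

definition divides_fully :: "real set set \<Rightarrow> real set \<Rightarrow> real set \<Rightarrow> real set \<Rightarrow> bool" where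
  "divides_fully I X M A \<longleftrightarrow>
     (\<forall>N\<subseteq>M. ideal_measurable I N \<longrightarrow> N \<inter> A \<in> I \<or> N \<inter> (X - A) \<in> I \<longrightarrow> N \<inter> X \<in> I)"

lemma all_subsets_measurable_in_mono:
  assumes Z: "all_subsets_measurable_in I Z" and "Y \<subseteq> Z"
  shows "all_subsets_measurable_in I Y"
  unfolding all_subsets_measurable_in_def
proof (intro allI impI)
  fix A assume A: "A \<subseteq> Y"
  then obtain M where M: "ideal_measurable I M" "A = M \<inter> Z"
    using assms unfolding all_subsets_measurable_in_def by (meson subset_trans)
  then have "A = M \<inter> Y"
    using A \<open>Y \<subseteq> Z\<close> by blast
  with M(1) show "\<exists>M. ideal_measurable I M \<and> A = M \<inter> Y" by blast
qed

lemma sigma_algebra_ideal_measurable: "sigma_algebra UNIV {M. ideal_measurable I M}"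
  unfolding ideal_measurable_def Collect_mem_eq
  by (rule sigma_algebra_sigma_sets) simp

lemma ideal_measurable_ideal: "A \<in> I \<Longrightarrow> ideal_measurable I A"
  by (auto simp: ideal_measurable_def intro: sigma_sets.Basic)

lemma ideal_measurable_Diff:
  "ideal_measurable I A \<Longrightarrow> ideal_measurable I B \<Longrightarrow> ideal_measurable I (A - B)"
proof -
  interpret sigma_algebra UNIV "{M. ideal_measurable I M}" by (rule sigma_algebra_ideal_measurable)
  show "ideal_measurable I A \<Longrightarrow> ideal_measurable I B \<Longrightarrow> ideal_measurable I (A - B)"
    using Diff by auto
qed

lemma ideal_measurable_UNIV: "ideal_measurable I UNIV"
proof -
  interpret sigma_algebra UNIV "{M. ideal_measurable I M}" by (rule sigma_algebra_ideal_measurable)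
  show ?thesis using top by auto
qed

lemma ideal_measurable_Int:
  "ideal_measurable I A \<Longrightarrow> ideal_measurable I B \<Longrightarrow> ideal_measurable I (A \<inter> B)"
proof -
  interpret sigma_algebra UNIV "{M. ideal_measurable I M}" by (rule sigma_algebra_ideal_measurable)
  show "ideal_measurable I A \<Longrightarrow> ideal_measurable I B \<Longrightarrow> ideal_measurable I (A \<inter> B)"
    using Int by auto
qed

lemma ideal_measurable_Union:
  assumes "countable G" "\<And>A. A \<in> G \<Longrightarrow> ideal_measurable I A"
  shows "ideal_measurable I (\<Union>G)"
proof -
  interpret sigma_algebra UNIV "{M. ideal_measurable I M}" by (rule sigma_algebra_ideal_measurable)
  show ?thesis using countable_Union[OF assms(1)] assms(2) by auto
qed

text \<open>
  Exhaustion is the form in which the countable chain condition of the quotient algebra is used: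
  it states that the supremum of any family of measurable sets exists modulo the ideal and is
  reached by a countable subfamily.
\<close>

locale exhaustible_sigma_ideal =
  fixes I :: "real set set"
  assumes subset_closed: "A \<in> I \<Longrightarrow> B \<subseteq> A \<Longrightarrow> B \<in> I"
    and Union_closed: "countable G \<Longrightarrow> G \<subseteq> I \<Longrightarrow> \<Union>G \<in> I"
    and singleton: "{x} \<in> I"
    and exhaustion: "(\<And>M. M \<in> F \<Longrightarrow> ideal_measurable I M) \<Longrightarrow>
      \<exists>G\<subseteq>F. countable G \<and> (\<forall>M\<in>F. M - \<Union>G \<in> I)"
begin

lemma empty: "{} \<in> I"
  using subset_closed[OF singleton] by simp

lemma UN_closed: "countable K \<Longrightarrow> (\<And>k. k \<in> K \<Longrightarrow> A k \<in> I) \<Longrightarrow> (\<Union>k\<in>K. A k) \<in> I"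
  by (rule Union_closed) auto

lemma Un_closed: "A \<in> I \<Longrightarrow> B \<in> I \<Longrightarrow> A \<union> B \<in> I"
  using Union_closed[of "{A, B}"] by auto

text \<open>
  The hull is the complement of the largest measurable set that meets \<open>A\<close> in a set of the ideal;
  exhaustion supplies that largest set as a countable union.
\<close>

lemma measurable_hull:
  obtains H where "ideal_measurable I H" "A \<subseteq> H"
    "\<And>M. ideal_measurable I M \<Longrightarrow> M \<inter> A \<in> I \<Longrightarrow> M \<inter> H \<in> I"
proof -
  define F where "F = {M. ideal_measurable I M \<and> M \<inter> A \<in> I}"
  obtain G where G: "G \<subseteq> F" "countable G" "\<And>M. M \<in> F \<Longrightarrow> M - \<Union>G \<in> I"
    using exhaustion[of F] unfolding F_def by blast
  \<comment> \<open>The trace of the union on \<open>A\<close>, which the hull has to take back in order to contain \<open>A\<close>.\<close>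
  define T where "T = (\<Union>M\<in>G. M \<inter> A)"
  have T: "T \<in> I"
    unfolding T_def using G(1,2) by (intro UN_closed) (auto simp: F_def)
  have U: "ideal_measurable I (\<Union>G)"
    using G(1,2) by (intro ideal_measurable_Union) (auto simp: F_def)
  define H where "H = UNIV - (\<Union>G - T)"
  show thesis
  proof
    show "ideal_measurable I H"
      unfolding H_def
      by (intro ideal_measurable_Diff U ideal_measurable_UNIV ideal_measurable_ideal T)
    show "A \<subseteq> H"
      by (auto simp: H_def T_def)
    fix M assume "ideal_measurable I M" "M \<inter> A \<in> I"
    then have "M - \<Union>G \<in> I" by (intro G) (auto simp: F_def)
    then have "(M - \<Union>G) \<union> T \<in> I" using T by (rule Un_closed)
    then show "M \<inter> H \<in> I"
      by (rule subset_closed) (auto simp: H_def)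
  qed
qed

text \<open>
  Cutting at the first initial segment outside the ideal replaces the usual choice of a set of
  least cardinality outside the ideal: the proper initial segments of the result lie in the ideal
  by minimality. For a strict linear order the complement of the upper section at \<open>x\<close> is the
  initial segment below \<open>x\<close> together with \<open>x\<close>.
\<close>

lemma sierpinski_relation_exists:
  assumes "Z \<notin> I"
  obtains Y r where "Y \<subseteq> Z" "Y \<notin> I" "sierpinski_relation I Y r"
proof -
  obtain R :: "real rel" where R: "well_order_on UNIV R"
    using well_order_on by blast
  define lt where "lt x y \<longleftrightarrow> (x, y) \<in> R - Id" for x y
  have wf: "wf (R - Id)" using R by (simp add: well_order_on_def)
  have total: "lt x y \<or> lt y x \<or> x = y" for x y
  proof -
    have "total_on UNIV R" using R by (simp add: well_order_on_def linear_order_on_def)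
    then show ?thesis by (auto simp: lt_def total_on_def)
  qed
  obtain Y where Y: "Y \<subseteq> Z" "Y \<notin> I" "\<And>y. y \<in> Y \<Longrightarrow> {x\<in>Z. lt x y} \<in> I"
  proof (cases "\<forall>a. {x\<in>Z. lt x a} \<in> I")
    case True
    then have "\<And>y. y \<in> Z \<Longrightarrow> {x\<in>Z. lt x y} \<in> I" by blast
    with that[OF subset_refl assms] show thesis by blast
  next
    case False
    then obtain a0 where a0: "a0 \<in> {a. {x\<in>Z. lt x a} \<notin> I}" by blast
    obtain a where a: "a \<in> {a. {x\<in>Z. lt x a} \<notin> I}"
      "\<And>b. (b, a) \<in> R - Id \<Longrightarrow> b \<notin> {a. {x\<in>Z. lt x a} \<notin> I}"
      by (rule wfE_min[OF wf a0]) blast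
    have "{x\<in>Z. lt x b} \<in> I" if "lt b a" for b
      using a(2)[of b] that by (auto simp: lt_def)
    then show thesis
      by (intro that[of "{x\<in>Z. lt x a}"]) (use a(1) in auto)
  qed
  have "{x\<in>Y. lt x y} \<in> I" if "y \<in> Y" for y
    by (rule subset_closed[OF Y(3)[OF that]]) (use Y(1) in blast)
  moreover have "{y\<in>Y. \<not> lt x y} \<in> I" if "x \<in> Y" for x
  proof (rule subset_closed)
    show "{y\<in>Z. lt y x} \<union> {x} \<in> I" by (intro Un_closed Y(3) that singleton)
    show "{y\<in>Y. \<not> lt x y} \<subseteq> {y\<in>Z. lt y x} \<union> {x}" using Y(1) total by blast
  qed
  ultimately have "sierpinski_relation I Y lt"
    by (simp add: sierpinski_relation_def)
  with that Y(1,2) show thesis .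
qed

text \<open>
  Below \<open>H1\<close> a set that is small on \<open>A\<close> is small, and below \<open>H2\<close> a set that is small on
  \<open>Z - A\<close> is small; below both, smallness on either part of \<open>X\<close> already forces smallness.
\<close>

lemma divides_fully_hulls:
  assumes A: "A \<subseteq> Z" and Z: "Z \<subseteq> X"
    and H1: "\<And>M. ideal_measurable I M \<Longrightarrow> M \<inter> A \<in> I \<Longrightarrow> M \<inter> H1 \<in> I"
    and H2: "\<And>M. ideal_measurable I M \<Longrightarrow> M \<inter> (Z - A) \<in> I \<Longrightarrow> M \<inter> H2 \<in> I"
  shows "divides_fully I X (H1 \<inter> H2) A"
  unfolding divides_fully_def
proof (intro allI impI)
  fix N assume N: "N \<subseteq> H1 \<inter> H2" "ideal_measurable I N"
    and or: "N \<inter> A \<in> I \<or> N \<inter> (X - A) \<in> I"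
  have "N \<inter> (X - A) \<in> I \<Longrightarrow> N \<inter> (Z - A) \<in> I"
    using subset_closed Z by (metis Diff_mono Int_mono order_refl)
  then have "N \<inter> H1 \<in> I \<or> N \<inter> H2 \<in> I"
    using or H1[OF N(2)] H2[OF N(2)] by blast
  moreover have "N \<inter> X \<subseteq> N \<inter> H1" "N \<inter> X \<subseteq> N \<inter> H2"
    using N(1) by auto
  ultimately show "N \<inter> X \<in> I"
    using subset_closed by blast
qed

text \<open>
  Gluing needs disjoint pieces, since different dividing sets may conflict on an overlap; on the
  \<open>n\<close>-th disjointed piece \<open>D n\<close> the glued set agrees with \<open>A n\<close>.
\<close>

lemma divides_fully_UN:
  fixes M A :: "nat \<Rightarrow> real set"
  assumes M: "\<And>n. ideal_measurable I (M n)"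
    and A: "\<And>n. A n \<subseteq> X" "\<And>n. divides_fully I X (M n) (A n)"
  obtains B where "B \<subseteq> X" "divides_fully I X (\<Union>n. M n) B"
proof -
  define D where "D n = M n - (\<Union>m<n. M m)" for n
  define B where "B = (\<Union>n. D n \<inter> A n)"
  have D: "ideal_measurable I (D n)" for n
    unfolding D_def by (intro ideal_measurable_Diff ideal_measurable_Union M) (auto intro: M)
  have UD: "(\<Union>n. M n) = (\<Union>n. D n)"
    unfolding D_def using UN_disjointed_eq[of M] by (simp add: disjointed_def lessThan_atLeast0)
  have disj: "D m \<inter> D n = {}" if "m \<noteq> n" for m n
    using that by (cases m n rule: linorder_cases) (auto simp: D_def)
  have DB: "D n \<inter> B = D n \<inter> A n" for n
    unfolding B_def using disj[of n] by (safe; metis Int_iff UN_I UNIV_I empty_iff)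
  have "divides_fully I X (\<Union>n. M n) B"
    unfolding divides_fully_def
  proof (intro allI impI)
    fix N assume N: "N \<subseteq> (\<Union>n. M n)" "ideal_measurable I N"
      and or: "N \<inter> B \<in> I \<or> N \<inter> (X - B) \<in> I"
    have "(N \<inter> D n) \<inter> X \<in> I" for n
    proof -
      have "ideal_measurable I (N \<inter> D n)" "N \<inter> D n \<subseteq> M n"
        using N(2) D by (auto intro: ideal_measurable_Int simp: D_def)
      moreover have "(N \<inter> D n) \<inter> A n \<in> I \<or> (N \<inter> D n) \<inter> (X - A n) \<in> I"
        using or
      proof (elim disjE)
        assume "N \<inter> B \<in> I"
        then have "(N \<inter> D n) \<inter> A n \<in> I"
          by (rule subset_closed) (use DB[of n] in blast)
        then show ?thesis ..
      next
        assume "N \<inter> (X - B) \<in> I"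
        then have "(N \<inter> D n) \<inter> (X - A n) \<in> I"
          by (rule subset_closed) (use DB[of n] in blast)
        then show ?thesis ..
      qed
      ultimately show ?thesis
        using A(2)[of n] unfolding divides_fully_def by blast
    qed
    then have "(\<Union>n. N \<inter> D n \<inter> X) \<in> I" by (intro UN_closed) auto
    then show "N \<inter> X \<in> I" by (rule subset_closed) (use N(1) UD in auto)
  qed
  moreover have "B \<subseteq> X" using A(1) by (auto simp: B_def)
  ultimately show thesis using that by blast
qed

text \<open>
  A maximal division is glued from countably many pieces. Whatever cannot be divided any further
  has only relatively measurable subsets, which the hypothesis rules out except inside the ideal.
\<close>

theorem full_decomposition:
  assumes no_sierpinski: "\<And>Y r. Y \<notin> I \<Longrightarrow> all_subsets_measurable_in I Y \<Longrightarrow>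
    sierpinski_relation I Y r \<Longrightarrow> False"
  shows "\<exists>X1 X2. X1 \<subseteq> X \<and> X2 \<subseteq> X \<and> X1 \<union> X2 = X \<and> X1 \<inter> X2 = {} \<and>
    full_in I X1 X \<and> full_in I X2 X"
proof -
  define F where "F = {M. ideal_measurable I M \<and> (\<exists>A\<subseteq>X. divides_fully I X M A)}"
  obtain G where G: "G \<subseteq> F" "countable G" "\<And>M. M \<in> F \<Longrightarrow> M - \<Union>G \<in> I"
    using exhaustion[of F] unfolding F_def by blast
  have "{} \<in> F"
    using empty by (auto simp: F_def divides_fully_def intro: ideal_measurable_ideal)
  \<comment> \<open>The empty piece is inserted because an enumeration by \<open>nat\<close> needs a nonempty set.\<close>
  define M where "M = from_nat_into (insert {} G)"
  have range_M: "range M = insert {} G"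
    unfolding M_def by (rule range_from_nat_into) (use G(2) in auto)
  then have MF: "M n \<in> F" for n
    using G(1) \<open>{} \<in> F\<close> by (metis insert_subset rangeI subsetD)
  then have "\<exists>A. A \<subseteq> X \<and> divides_fully I X (M n) A" for n
    by (auto simp: F_def)
  then obtain A where A: "\<And>n. A n \<subseteq> X" "\<And>n. divides_fully I X (M n) (A n)"
    by metis
  define U where "U = (\<Union>n. M n)"
  have UG: "U = \<Union>G" unfolding U_def range_M by simp
  have MM: "ideal_measurable I (M n)" for n
    using MF by (auto simp: F_def)
  obtain B where B: "B \<subseteq> X" "divides_fully I X U B"
    using divides_fully_UN[where M=M and A=A and X=X] MM A unfolding U_def by metis
  have U: "ideal_measurable I U"
    unfolding U_def by (rule ideal_measurable_Union) (auto intro: MM)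
  have rest: "X - U \<in> I"
  proof (rule ccontr)
    assume notin: "X - U \<notin> I"
    have all: "all_subsets_measurable_in I (X - U)"
      unfolding all_subsets_measurable_in_def
    proof (intro allI impI)
      fix A assume A: "A \<subseteq> X - U"
      obtain H1 where H1: "ideal_measurable I H1" "A \<subseteq> H1"
        "\<And>M. ideal_measurable I M \<Longrightarrow> M \<inter> A \<in> I \<Longrightarrow> M \<inter> H1 \<in> I"
        using measurable_hull[of A] by metis
      obtain H2 where H2: "ideal_measurable I H2" "(X - U) - A \<subseteq> H2"
        "\<And>M. ideal_measurable I M \<Longrightarrow> M \<inter> ((X - U) - A) \<in> I \<Longrightarrow> M \<inter> H2 \<in> I"
        using measurable_hull[of "(X - U) - A"] by metis
      \<comment> \<open>The hulls overlap only in a set which can be divided, hence inside \<open>U\<close> modulo the ideal;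
        off \<open>U\<close> they separate \<open>A\<close> from its complement.\<close>
      have "divides_fully I X (H1 \<inter> H2) A"
        by (rule divides_fully_hulls[OF A]) (use H1 H2 in auto)
      then have "H1 \<inter> H2 \<in> F"
        using A H1 H2 by (auto simp: F_def intro: ideal_measurable_Int)
      then have "H1 \<inter> H2 - U \<in> I" unfolding UG by (rule G)
      then have E: "(H1 \<inter> (X - U)) - A \<in> I"
        by (rule subset_closed) (use H2(2) in auto)
      let ?M = "H1 - ((H1 \<inter> (X - U)) - A)"
      have "ideal_measurable I ?M"
        by (intro ideal_measurable_Diff H1 ideal_measurable_ideal E)
      moreover have "A = ?M \<inter> (X - U)" using A H1(2) by auto
      ultimately show "\<exists>M. ideal_measurable I M \<and> A = M \<inter> (X - U)" by blast
    qed
    obtain Y r where Y: "Y \<subseteq> X - U" "Y \<notin> I" "sierpinski_relation I Y r"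
      using sierpinski_relation_exists[OF notin] by metis
    show False
      using no_sierpinski[OF Y(2) all_subsets_measurable_in_mono[OF all Y(1)] Y(3)] .
  qed
  have full: "N \<inter> X \<in> I" if N: "ideal_measurable I N" and or: "N \<inter> B \<in> I \<or> N \<inter> (X - B) \<in> I" for N
  proof -
    have "(N \<inter> U) \<inter> B \<in> I \<or> (N \<inter> U) \<inter> (X - B) \<in> I"
      using or subset_closed[of "N \<inter> B" "(N \<inter> U) \<inter> B"]
        subset_closed[of "N \<inter> (X - B)" "(N \<inter> U) \<inter> (X - B)"] by blast
    then have "(N \<inter> U) \<inter> X \<in> I"
      using B(2) ideal_measurable_Int[OF N U] unfolding divides_fully_def by blast
    from Un_closed[OF this rest] show ?thesis
      by (rule subset_closed) auto
  qed
  have sub: "N \<inter> X \<in> I \<Longrightarrow> A \<subseteq> X \<Longrightarrow> N \<inter> A \<in> I" for N A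
    by (rule subset_closed) auto
  have "full_in I B X" "full_in I (X - B) X"
    unfolding full_in_def using full sub B(1) by blast+
  then show ?thesis
    using B(1) by (intro exI[of _ B] exI[of _ "X - B"]) auto
qed

end

section \<open>Lebesgue null sets\<close>

text \<open>
  A countable subfamily whose union has the largest possible measure absorbs every member, since
  a member sticking out by a positive measure would enlarge that union.
\<close>

lemma finite_measure_exhaustion:
  assumes "finite_measure M" and F: "F \<subseteq> sets M"
  shows "\<exists>G\<subseteq>F. countable G \<and> (\<forall>A\<in>F. A - \<Union>G \<in> null_sets M)"
proof -
  interpret finite_measure M by fact
  define C where "C = {G. G \<subseteq> F \<and> countable G}"
  define s where "s = (SUP G\<in>C. measure M (\<Union>G))"
  have sets: "\<Union>G \<in> sets M" if "G \<in> C" for G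
    using that F by (auto simp: C_def intro!: sets.countable_Union)
  have "{} \<in> C" by (simp add: C_def)
  have bdd: "bdd_above ((\<lambda>G. measure M (\<Union>G)) ` C)"
    by (rule bdd_aboveI2[where M="measure M (space M)"]) (rule bounded_measure)
  have "\<exists>G\<in>C. s - 1 / Suc n < measure M (\<Union>G)" for n
    using \<open>{} \<in> C\<close> bdd unfolding s_def by (subst less_cSUP_iff[symmetric]) auto
  then obtain G where G: "\<And>n. G n \<in> C" "\<And>n. s - 1 / Suc n < measure M (\<Union>(G n))"
    by metis
  define H where "H = (\<Union>n. G n)"
  have "H \<in> C" using G(1) by (auto simp: H_def C_def)
  have H_max: "s \<le> measure M (\<Union>H)"
  proof (rule field_le_epsilon)
    fix e :: real assume "0 < e"
    then obtain n where n: "1 / Suc n < e" using nat_approx_posE by metis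
    have "measure M (\<Union>(G n)) \<le> measure M (\<Union>H)"
      by (rule finite_measure_mono) (use sets[OF \<open>H \<in> C\<close>] in \<open>auto simp: H_def\<close>)
    with G(2)[of n] n show "s \<le> measure M (\<Union>H) + e" by linarith
  qed
  have "A - \<Union>H \<in> null_sets M" if A: "A \<in> F" for A
  proof -
    have "insert A H \<in> C" using A \<open>H \<in> C\<close> by (simp add: C_def)
    then have "measure M (\<Union>(insert A H)) \<le> s"
      unfolding s_def by (intro cSUP_upper bdd)
    moreover have "measure M (\<Union>(insert A H)) = measure M (\<Union>H) + measure M (A - \<Union>H)"
      using finite_measure_Union[of "\<Union>H" "A - \<Union>H"] sets[OF \<open>H \<in> C\<close>] A F
      by (auto simp: Un_commute)
    ultimately have "measure M (A - \<Union>H) = 0"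
      using H_max measure_nonneg[of M "A - \<Union>H"] by linarith
    then show ?thesis
      using sets[OF \<open>H \<in> C\<close>] A F by (auto simp: null_sets_def emeasure_eq_measure)
  qed
  then show ?thesis using \<open>H \<in> C\<close> by (auto simp: C_def)
qed

lemma ideal_measurable_null_iff: "ideal_measurable null_ideal M \<longleftrightarrow> M \<in> sets lebesgue"
proof
  assume "ideal_measurable null_ideal M"
  then have "M \<in> sigma_sets (space lebesgue) (sets borel \<union> null_sets lebesgue)"
    by (simp add: ideal_measurable_def null_ideal_def)
  then show "M \<in> sets lebesgue"
    by (rule sets.sigma_sets_subset[THEN subsetD, rotated]) auto
next
  assume "M \<in> sets lebesgue"
  then obtain S N N' where "M = S \<union> N" "N \<subseteq> N'" "N' \<in> null_sets lborel" "S \<in> sets lborel"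
    by (rule sets_completionE)
  then have "M = \<Union>{S, N}" "S \<in> sets borel" "N \<in> null_ideal"
    unfolding null_ideal_def null_sets_completion_iff2 by auto
  then show "ideal_measurable null_ideal M"
    by (simp only:, intro ideal_measurable_Union)
      (auto intro: ideal_measurable_ideal sigma_sets.Basic simp: ideal_measurable_def)
qed

interpretation null: exhaustible_sigma_ideal null_ideal
proof
  show "A \<in> null_ideal \<Longrightarrow> B \<subseteq> A \<Longrightarrow> B \<in> null_ideal" for A B
    unfolding null_ideal_def by (rule null_sets_completion_subset)
  show "countable G \<Longrightarrow> G \<subseteq> null_ideal \<Longrightarrow> \<Union>G \<in> null_ideal" for G
    unfolding null_ideal_def using null_sets_UN'[of G "\<lambda>x. x" lebesgue] by auto
  show "{x} \<in> null_ideal" for x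
    by (simp add: null_ideal_def null_sets_def)
  fix F assume "\<And>M. M \<in> F \<Longrightarrow> ideal_measurable null_ideal M"
  then have F: "F \<subseteq> sets lebesgue" by (auto simp: ideal_measurable_null_iff)
  define K where "K n = cball (0::real) (real n)" for n
  have "\<exists>G\<subseteq>F. countable G \<and> (\<forall>A\<in>F. (A - \<Union>G) \<inter> K n \<in> null_sets lebesgue)" for n
  proof -
    have K: "K n \<in> lmeasurable" by (simp add: K_def)
    have fin: "finite_measure (lebesgue_on (K n))"
      by (rule finite_measure_lebesgue_on[OF K])
    have "(\<lambda>A. A \<inter> K n) ` F \<subseteq> sets (lebesgue_on (K n))"
      using F K by (auto simp: sets_restrict_space)
    from finite_measure_exhaustion[OF fin this]
    obtain G' where G': "G' \<subseteq> (\<lambda>A. A \<inter> K n) ` F" "countable G'"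
      "\<And>A. A \<in> F \<Longrightarrow> A \<inter> K n - \<Union>G' \<in> null_sets (lebesgue_on (K n))"
      by auto
    obtain G where G: "G \<subseteq> F" "countable G" "G' = (\<lambda>A. A \<inter> K n) ` G"
      using G'(1,2) by (metis countable_subset_image)
    have "(A - \<Union>G) \<inter> K n \<in> null_sets lebesgue" if "A \<in> F" for A
    proof -
      have "(A - \<Union>G) \<inter> K n = A \<inter> K n - \<Union>G'" by (auto simp: G(3))
      then show ?thesis
        using G'(3)[OF that] K by (simp add: null_sets_restrict_space)
    qed
    with G show ?thesis by blast
  qed
  then obtain G where G: "\<And>n. G n \<subseteq> F" "\<And>n. countable (G n)"
    "\<And>n A. A \<in> F \<Longrightarrow> (A - \<Union>(G n)) \<inter> K n \<in> null_sets lebesgue"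
    by metis
  show "\<exists>G\<subseteq>F. countable G \<and> (\<forall>M\<in>F. M - \<Union>G \<in> null_ideal)"
  proof (intro exI conjI ballI)
    show "(\<Union>n. G n) \<subseteq> F" "countable (\<Union>n. G n)" using G by auto
    fix A assume A: "A \<in> F"
    have "(\<Union>n. (A - \<Union>(G n)) \<inter> K n) \<in> null_sets lebesgue"
      by (intro null_sets_UN G A)
    moreover have "A - \<Union>(\<Union>n. G n) \<subseteq> (\<Union>n. (A - \<Union>(G n)) \<inter> K n)"
      using real_arch_simple by (fastforce simp: K_def)
    ultimately show "A - \<Union>(\<Union>n. G n) \<in> null_ideal"
      unfolding null_ideal_def by (rule null_sets_completion_subset[rotated])
  qed
qed

text \<open>
  After restriction to a bounded part \<open>Y\<close> with hull \<open>K\<close> of measure \<open>k\<close>, cover each section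
  \<open>{x\<in>Y. r x y}\<close> by an open set \<open>U y\<close> of measure at most \<open>k / 2\<close>. The relation \<open>x \<in> U y\<close> extends
  to a measurable set \<open>E \<subseteq> K \<times> K\<close>. Being measurable, conditions on the sections of \<open>E\<close> that hold
  on \<open>Y\<close> hold almost everywhere on the hull \<open>K\<close>. Integrating one way gives \<open>E\<close> measure at most
  \<open>k\<^sup>2 / 2\<close>, integrating the other way gives it measure \<open>k\<^sup>2\<close>.
\<close>

lemma no_sierpinski_relation_null:
  assumes Y0: "Y0 \<notin> null_ideal" and all: "all_subsets_measurable_in null_ideal Y0"
    and sier: "sierpinski_relation null_ideal Y0 r"
  shows False
proof -
  have "(\<Union>n. Y0 \<inter> cball 0 (real n)) = Y0"
    using real_arch_simple by fastforce
  then obtain n where Y: "Y0 \<inter> cball 0 (real n) \<notin> null_ideal"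
    using Y0 null.UN_closed[of UNIV "\<lambda>n. Y0 \<inter> cball 0 (real n)"] by force
  define Y where "Y = Y0 \<inter> cball 0 (real n)"
  have Y: "Y \<notin> null_ideal" "Y \<subseteq> Y0"
    using Y by (auto simp: Y_def)
  obtain H where H: "ideal_measurable null_ideal H" "Y \<subseteq> H"
    "\<And>M. ideal_measurable null_ideal M \<Longrightarrow> M \<inter> Y \<in> null_ideal \<Longrightarrow> M \<inter> H \<in> null_ideal"
    using null.measurable_hull[of Y] by metis
  define K where "K = H \<inter> cball 0 (real n)"
  have YK: "Y \<subseteq> K" using H(2) by (auto simp: K_def Y_def)
  have K: "K \<in> lmeasurable"
    using H(1) unfolding K_def ideal_measurable_null_iff
    by (intro bounded_set_imp_lmeasurable) (auto intro: bounded_subset[of "cball 0 (real n)"])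
  define L where "L = lebesgue_on K"
  interpret L: finite_measure L
    unfolding L_def by (rule finite_measure_lebesgue_on[OF K])
  interpret LL: pair_sigma_finite L L ..
  have space_L: "space L = K" by (simp add: L_def)
  have sets_L: "A \<inter> K \<in> sets L" if "A \<in> sets lebesgue" for A
    using that K by (auto simp: L_def sets_restrict_space)
  have emeasure_L: "emeasure L (A \<inter> K) = emeasure lebesgue (A \<inter> K)" for A
    unfolding L_def by (rule emeasure_restrict_space) (use K in auto)
  have AE_L: "AE y in L. P y" if P: "{y\<in>K. \<not> P y} \<in> sets L" "{y\<in>Y. \<not> P y} \<in> null_ideal" for P
  proof -
    have "ideal_measurable null_ideal {y\<in>K. \<not> P y}"
      using P(1) K unfolding ideal_measurable_null_iff L_def by (auto simp: sets_restrict_space_iff)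
    moreover have "{y\<in>K. \<not> P y} \<inter> Y \<in> null_ideal"
      by (rule null.subset_closed[OF P(2)]) auto
    ultimately have "{y\<in>K. \<not> P y} \<inter> H \<in> null_ideal"
      by (rule H(3))
    moreover have "{y\<in>K. \<not> P y} \<inter> H = {y\<in>K. \<not> P y}" by (auto simp: K_def)
    ultimately have "{y\<in>K. \<not> P y} \<in> null_sets L"
      using P(1) K by (simp add: null_ideal_def L_def null_sets_restrict_space)
    then show ?thesis by (rule AE_I') (auto simp: space_L)
  qed
  have AE_on_Y: "AE y in L. P y" if "{y\<in>K. \<not> P y} \<in> sets L" "\<And>y. y \<in> Y \<Longrightarrow> P y" for P
    by (rule AE_L[OF that(1)]) (use that(2) null.empty in \<open>simp cong: conj_cong\<close>)
  define k where "k = measure lebesgue K"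
  have eK: "emeasure L K = ennreal k"
    using emeasure_L[of K] K by (simp add: k_def emeasure_eq_measure2)
  have "k > 0"
  proof (rule ccontr)
    assume "\<not> k > 0"
    then have "k = 0" using measure_nonneg[of lebesgue K] by (simp add: k_def)
    then have "emeasure lebesgue K = 0"
      using emeasure_eq_measure2[OF K] by (simp add: k_def)
    then have "K \<in> null_sets lebesgue"
      using K by (intro null_setsI) auto
    then show False using Y(1) YK null.subset_closed unfolding null_ideal_def by blast
  qed
  have "\<exists>U. open U \<and> {x\<in>Y. r x y} \<subseteq> U \<and> emeasure lebesgue U \<le> ennreal (k / 2)" if "y \<in> Y" for y
  proof -
    let ?D = "{x\<in>Y. r x y}"
    have D: "?D \<in> null_sets lebesgue"
    proof (rule null.subset_closed[unfolded null_ideal_def])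
      show "{x\<in>Y0. r x y} \<in> null_sets lebesgue"
        using sier that Y(2) unfolding sierpinski_relation_def null_ideal_def by blast
    qed (use Y(2) in auto)
    then obtain U where "open U" "?D \<subseteq> U" and U: "emeasure lebesgue (U - ?D) < ennreal (k / 2)"
      by (rule sets_lebesgue_outer_open[OF null_setsD2 half_gt_zero[OF \<open>k > 0\<close>]])
    moreover have "emeasure lebesgue (U - ?D) = emeasure lebesgue U"
      using D \<open>open U\<close> by (intro emeasure_Diff_null_set) auto
    ultimately show ?thesis by (auto intro: less_imp_le)
  qed
  then obtain U where U: "\<And>y. y \<in> Y \<Longrightarrow> open (U y)" "\<And>y. y \<in> Y \<Longrightarrow> {x\<in>Y. r x y} \<subseteq> U y"
    "\<And>y. y \<in> Y \<Longrightarrow> emeasure lebesgue (U y) \<le> ennreal (k / 2)"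
    by metis
  obtain \<B> :: "real set set" where \<B>: "countable \<B>" "topological_basis \<B>"
    using ex_countable_basis by blast
  have "\<exists>M. M \<in> sets lebesgue \<and> {y\<in>Y. B \<subseteq> U y} = M \<inter> Y" for B
    using all_subsets_measurable_in_mono[OF all Y(2)]
    unfolding all_subsets_measurable_in_def ideal_measurable_null_iff by simp
  then obtain M where M: "\<And>B. M B \<in> sets lebesgue" "\<And>B. {y\<in>Y. B \<subseteq> U y} = M B \<inter> Y"
    by metis
  \<comment> \<open>Each \<open>U y\<close> is the union of the basic sets inside it, which makes \<open>E\<close> a code for \<open>x \<in> U y\<close>.\<close>
  define E where "E = (\<Union>B\<in>\<B>. (B \<inter> K) \<times> (M B \<inter> K))"
  have E: "E \<in> sets (L \<Otimes>\<^sub>M L)"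
    unfolding E_def
  proof (intro sets.countable_UN' \<B>(1) image_subsetI)
    fix B assume "B \<in> \<B>"
    then have "B \<in> sets lebesgue" using topological_basis_open[OF \<B>(2)] by auto
    then show "(B \<inter> K) \<times> (M B \<inter> K) \<in> sets (L \<Otimes>\<^sub>M L)"
      by (intro pair_measureI sets_L M(1))
  qed
  have inE: "(x, y) \<in> E \<longleftrightarrow> x \<in> U y" if xy: "x \<in> K" "y \<in> Y" for x y
  proof
    assume "(x, y) \<in> E"
    then obtain B where "B \<in> \<B>" "x \<in> B" "y \<in> M B" by (auto simp: E_def)
    then show "x \<in> U y" using M(2)[of B] xy by blast
  next
    assume "x \<in> U y"
    then obtain B where "B \<in> \<B>" "x \<in> B" "B \<subseteq> U y"
      using topological_basisE[OF \<B>(2) U(1)[OF xy(2)]] by metis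
    then show "(x, y) \<in> E" using M(2)[of B] xy YK by (auto simp: E_def)
  qed
  have "AE y in L. emeasure L ((\<lambda>x. (x, y)) -` E) \<le> ennreal (k / 2)"
  proof (rule AE_on_Y)
    have [measurable]: "(\<lambda>y. emeasure L ((\<lambda>x. (x, y)) -` E)) \<in> borel_measurable L"
      by (rule LL.measurable_emeasure_Pair2[OF E])
    have "{y\<in>space L. \<not> emeasure L ((\<lambda>x. (x, y)) -` E) \<le> ennreal (k / 2)} \<in> sets L"
      by measurable
    then show "{y\<in>K. \<not> emeasure L ((\<lambda>x. (x, y)) -` E) \<le> ennreal (k / 2)} \<in> sets L"
      by (simp add: space_L)
    fix y assume y: "y \<in> Y"
    have "(\<lambda>x. (x, y)) -` E = U y \<inter> K"
      using inE[OF _ y] by (auto simp: E_def)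
    then have "emeasure L ((\<lambda>x. (x, y)) -` E) = emeasure lebesgue (U y \<inter> K)"
      by (simp add: emeasure_L)
    also have "\<dots> \<le> emeasure lebesgue (U y)"
      using U(1)[OF y] by (intro emeasure_mono) auto
    finally show "emeasure L ((\<lambda>x. (x, y)) -` E) \<le> ennreal (k / 2)"
      using U(3)[OF y] by simp
  qed
  then have "(\<integral>\<^sup>+y. emeasure L ((\<lambda>x. (x, y)) -` E) \<partial>L) \<le> (\<integral>\<^sup>+y. ennreal (k / 2) \<partial>L)"
    by (rule nn_integral_mono_AE)
  then have small: "emeasure (L \<Otimes>\<^sub>M L) E \<le> ennreal (k / 2) * ennreal k"
    by (simp add: LL.emeasure_pair_measure_alt2[OF E] space_L eK)
  have "AE x in L. emeasure L (Pair x -` E) = ennreal k"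
  proof (rule AE_on_Y)
    have [measurable]: "(\<lambda>x. emeasure L (Pair x -` E)) \<in> borel_measurable L"
      by (rule L.measurable_emeasure_Pair[OF E])
    have "{x\<in>space L. \<not> emeasure L (Pair x -` E) = ennreal k} \<in> sets L"
      by measurable
    then show "{x\<in>K. \<not> emeasure L (Pair x -` E) = ennreal k} \<in> sets L"
      by (simp add: space_L)
    fix x assume x: "x \<in> Y"
    have N: "{y\<in>Y. \<not> r x y} \<in> null_ideal"
      using sier x Y(2) null.subset_closed[of "{y\<in>Y0. \<not> r x y}" "{y\<in>Y. \<not> r x y}"]
      unfolding sierpinski_relation_def by blast
    have "AE y in L. (x, y) \<in> E"
    proof (rule AE_L)
      have "K - Pair x -` E \<in> sets L"
        using sets.top[of L] sets_Pair1[OF E] unfolding space_L by (rule sets.Diff)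
      moreover have "K - Pair x -` E = {y\<in>K. (x, y) \<notin> E}" by auto
      ultimately show "{y\<in>K. (x, y) \<notin> E} \<in> sets L" by simp
      show "{y\<in>Y. (x, y) \<notin> E} \<in> null_ideal"
        by (rule null.subset_closed[OF N]) (use inE x U(2) YK in blast)
    qed
    then have "AE y in L. y \<in> Pair x -` E" by simp
    then have "emeasure L (Pair x -` E) = emeasure L (space L)"
      using AE_space[of L] by (intro emeasure_eq_AE sets_Pair1[OF E] sets.top) auto
    then show "emeasure L (Pair x -` E) = ennreal k" by (simp add: space_L eK)
  qed
  then have "(\<integral>\<^sup>+x. emeasure L (Pair x -` E) \<partial>L) = (\<integral>\<^sup>+x. ennreal k \<partial>L)"
    by (rule nn_integral_cong_AE)
  then have "emeasure (L \<Otimes>\<^sub>M L) E = ennreal k * ennreal k"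
    by (simp add: L.emeasure_pair_measure_alt[OF E] space_L eK)
  moreover have "ennreal (k * k) = ennreal k * ennreal k"
    "ennreal (k / 2 * k) = ennreal (k / 2) * ennreal k"
    by (rule ennreal_mult; use \<open>k > 0\<close> in simp)+
  ultimately have "ennreal (k * k) \<le> ennreal (k / 2 * k)"
    using small by simp
  then show False
    using \<open>k > 0\<close> by (simp add: ennreal_le_iff)
qed

section \<open>Meager sets\<close>

lemma nowhere_dense_subset: "nowhere_dense A \<Longrightarrow> B \<subseteq> A \<Longrightarrow> nowhere_dense B"
  unfolding nowhere_dense_def by (metis closure_mono interior_mono subset_empty)

lemma meager_iff:
  "meager S \<longleftrightarrow> (\<exists>F. countable F \<and> (\<forall>A\<in>F. nowhere_dense A) \<and> S \<subseteq> \<Union>F)"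
proof
  assume "meager S"
  then obtain A :: "nat \<Rightarrow> 'a set" where "\<forall>n. nowhere_dense (A n)" "S = (\<Union>n. A n)"
    unfolding meager_def by blast
  then show "\<exists>F. countable F \<and> (\<forall>A\<in>F. nowhere_dense A) \<and> S \<subseteq> \<Union>F"
    by (intro exI[of _ "range A"]) auto
next
  assume "\<exists>F. countable F \<and> (\<forall>A\<in>F. nowhere_dense A) \<and> S \<subseteq> \<Union>F"
  then obtain F where F: "countable F" "\<forall>A\<in>F. nowhere_dense A" "S \<subseteq> \<Union>F" by blast
  define A where "A = from_nat_into (insert {} F)"
  have A: "range A = insert {} F"
    unfolding A_def by (rule range_from_nat_into) (use F(1) in auto)
  have "nowhere_dense N" if "N \<in> insert {} F" for N
    using F(2) that by (auto simp: nowhere_dense_def)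
  then have "nowhere_dense (A n)" for n
    using A rangeI[of A n] by simp
  then have "nowhere_dense (S \<inter> A n)" for n
    by (rule nowhere_dense_subset) auto
  moreover have "S = S \<inter> \<Union>(range A)"
    unfolding A using F(3) by auto
  then have "S = (\<Union>n. S \<inter> A n)" by simp
  ultimately show "meager S"
    unfolding meager_def by (intro exI[of _ "\<lambda>n. S \<inter> A n"] conjI allI)
qed

lemma nowhere_dense_imp_meager: "nowhere_dense A \<Longrightarrow> meager A"
  unfolding meager_iff by (intro exI[of _ "{A}"]) auto

lemma meager_subset: "meager A \<Longrightarrow> B \<subseteq> A \<Longrightarrow> meager B"
  unfolding meager_iff by (meson subset_trans)

lemma meager_UN:
  assumes "countable K" "\<And>k. k \<in> K \<Longrightarrow> meager (A k)"
  shows "meager (\<Union>k\<in>K. A k)"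
proof -
  obtain F where F: "\<And>k. k \<in> K \<Longrightarrow> countable (F k) \<and> (\<forall>A\<in>F k. nowhere_dense A) \<and> A k \<subseteq> \<Union>(F k)"
    using assms(2) unfolding meager_iff by metis
  show ?thesis
    unfolding meager_iff
    by (intro exI[of _ "\<Union>k\<in>K. F k"] conjI countable_UN assms(1)) (use F in fastforce)+
qed

lemma meager_Un: "meager A \<Longrightarrow> meager B \<Longrightarrow> meager (A \<union> B)"
  using meager_UN[of "{A, B}" "\<lambda>x. x"] by auto

lemma nowhere_dense_frontier_open:
  assumes "open U"
  shows "nowhere_dense (closure U - U)"
proof -
  have "closed (closure U - U)" using assms by (simp add: closed_Diff)
  moreover have "interior (closure U - U) = {}"
  proof -
    have "interior (closure U - U) \<inter> U = {}" using interior_subset by blast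
    then have "interior (closure U - U) \<inter> closure U = {}"
      by (simp add: open_Int_closure_eq_empty)
    then show ?thesis using interior_subset by blast
  qed
  ultimately show ?thesis by (simp add: nowhere_dense_def)
qed

text \<open>This is the property of Baire.\<close>

definition almost_open :: "'a::topological_space set \<Rightarrow> bool" where
  "almost_open S \<longleftrightarrow> (\<exists>U. open U \<and> meager ((S - U) \<union> (U - S)))"

lemma almost_openI: "open U \<Longrightarrow> meager A \<Longrightarrow> S - U \<subseteq> A \<Longrightarrow> U - S \<subseteq> A \<Longrightarrow> almost_open S"
  unfolding almost_open_def using meager_subset by (metis Un_least)

lemma meager_empty: "meager {}"
  unfolding meager_iff by (intro exI[of _ "{}"]) auto

lemma open_imp_almost_open: "open S \<Longrightarrow> almost_open S"
  by (rule almost_openI[of S "{}"]) (auto simp: meager_empty)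

lemma meager_imp_almost_open: "meager S \<Longrightarrow> almost_open S"
  by (rule almost_openI[of "{}" S]) auto

text \<open>
  If \<open>U\<close> approximates \<open>S\<close>, the open exterior of \<open>U\<close> approximates the complement of \<open>S\<close>; the
  two differ from complements only on the boundary of \<open>U\<close>, which is nowhere dense.
\<close>

lemma almost_open_Compl:
  assumes "almost_open S"
  shows "almost_open (- S)"
proof -
  obtain U where U: "open U" "meager ((S - U) \<union> (U - S))"
    using assms unfolding almost_open_def by blast
  show ?thesis
  proof (rule almost_openI)
    show "open (- closure U)" by (rule open_Compl[OF closed_closure])
    show "meager (((S - U) \<union> (U - S)) \<union> (closure U - U))"
      by (intro meager_Un U nowhere_dense_imp_meager nowhere_dense_frontier_open)
    show "- S - - closure U \<subseteq> ((S - U) \<union> (U - S)) \<union> (closure U - U)" by blast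
    show "- closure U - - S \<subseteq> ((S - U) \<union> (U - S)) \<union> (closure U - U)"
      using closure_subset[of U] by blast
  qed
qed

lemma almost_open_UN:
  fixes S :: "nat \<Rightarrow> 'a::topological_space set"
  assumes "\<And>n. almost_open (S n)"
  shows "almost_open (\<Union>n. S n)"
proof -
  obtain U where U: "\<And>n. open (U n)" "\<And>n. meager ((S n - U n) \<union> (U n - S n))"
    using assms unfolding almost_open_def by metis
  show ?thesis
  proof (rule almost_openI)
    show "open (\<Union>n. U n)" using U(1) by blast
    show "meager (\<Union>n. (S n - U n) \<union> (U n - S n))"
      by (intro meager_UN U) auto
  qed auto
qed

lemma ideal_measurable_meager_imp_almost_open:
  assumes "ideal_measurable meager_ideal M"
  shows "almost_open M"
proof -
  have *: "almost_open M" if "M \<in> sigma_sets UNIV G" "\<And>S. S \<in> G \<Longrightarrow> almost_open S"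
    for G and M :: "real set"
    using that(1)
    by induction (auto intro: that(2) open_imp_almost_open almost_open_Compl almost_open_UN
      simp flip: Compl_eq_Diff_UNIV)
  have "almost_open S" if "S \<in> sets borel" for S :: "real set"
    by (rule *[of _ "{S. open S}"]) (use that in \<open>auto simp: sets_borel intro: open_imp_almost_open\<close>)
  then show ?thesis
    using assms unfolding ideal_measurable_def
    by (rule_tac *) (auto simp: meager_ideal_def intro: meager_imp_almost_open)
qed

text \<open>
  Exhaustion comes from the Lindelof property, applied to open sets that approximate the members
  of the family.
\<close>

interpretation meager: exhaustible_sigma_ideal meager_ideal
proof
  show "A \<in> meager_ideal \<Longrightarrow> B \<subseteq> A \<Longrightarrow> B \<in> meager_ideal" for A B
    unfolding meager_ideal_def using meager_subset by blast
  show "countable G \<Longrightarrow> G \<subseteq> meager_ideal \<Longrightarrow> \<Union>G \<in> meager_ideal" for G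
    unfolding meager_ideal_def using meager_UN[of G "\<lambda>x. x"] by auto
  show "{x} \<in> meager_ideal" for x
    by (auto simp: meager_ideal_def nowhere_dense_def intro: nowhere_dense_imp_meager)
  fix F assume F: "\<And>M. M \<in> F \<Longrightarrow> ideal_measurable meager_ideal M"
  have "\<exists>U. open U \<and> meager ((M - U) \<union> (U - M))" if "M \<in> F" for M
    using ideal_measurable_meager_imp_almost_open[OF F[OF that]] unfolding almost_open_def .
  then obtain U where U: "\<And>M. M \<in> F \<Longrightarrow> open (U M)"
    "\<And>M. M \<in> F \<Longrightarrow> meager ((M - U M) \<union> (U M - M))"
    by metis
  obtain \<U> where \<U>: "\<U> \<subseteq> U ` F" "countable \<U>" "\<Union>\<U> = \<Union>(U ` F)"
    using Lindelof[of "U ` F"] U(1) by auto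
  then obtain G where G: "G \<subseteq> F" "countable G" "\<U> = U ` G"
    by (metis countable_subset_image)
  have "M - \<Union>G \<in> meager_ideal" if M: "M \<in> F" for M
  proof -
    let ?E = "((M - U M) \<union> (U M - M)) \<union> (\<Union>N\<in>G. (N - U N) \<union> (U N - N))"
    have "meager ?E" using G M by (intro meager_Un[OF U(2)] meager_UN U(2)) auto
    moreover have "U M \<subseteq> \<Union>(U ` G)" using \<U>(3) G(3) M by blast
    then have "M - \<Union>G \<subseteq> ?E" by blast
    ultimately show ?thesis unfolding meager_ideal_def using meager_subset by blast
  qed
  with G show "\<exists>G\<subseteq>F. countable G \<and> (\<forall>M\<in>F. M - \<Union>G \<in> meager_ideal)" by blast
qed

text \<open>
  Each section \<open>{x\<in>Y. r x y}\<close> is a union of nowhere dense sets \<open>C y n\<close>. For basic open \<open>B\<close>, the set of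
  \<open>y\<close> such that \<open>B\<close> misses \<open>C y n\<close> is the trace of a measurable set, hence of an open set \<open>V n B\<close>
  after a meager set is removed from \<open>Y\<close>, leaving \<open>Y'\<close>. Consider the open subsets
  \<open>\<Union>B. B \<times> V n B\<close> of the plane: their horizontal sections at points of \<open>Y'\<close> are dense. As in the theorem of
  Kuratowski and Ulam, for all \<open>x\<close> outside a meager set the vertical section \<open>T n x\<close> is dense
  near \<open>Y'\<close>, for every \<open>n\<close>. Some such \<open>x\<close> lies in \<open>Y'\<close>, and then all \<open>y \<in> Y'\<close> outside a meager set
  lie in \<open>T n x\<close> for every \<open>n\<close>, which means that \<open>x\<close> avoids every \<open>C y n\<close>, so \<open>\<not> r x y\<close>. This
  contradicts the fact that \<open>r x y\<close> fails only for a meager set of \<open>y\<close>.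
\<close>

lemma no_sierpinski_relation_meager:
  assumes Y: "Y \<notin> meager_ideal" and all: "all_subsets_measurable_in meager_ideal Y"
    and sier: "sierpinski_relation meager_ideal Y r"
  shows False
proof -
  have "\<forall>y\<in>Y. \<exists>C. (\<forall>n::nat. nowhere_dense (C n)) \<and> {x\<in>Y. r x y} = (\<Union>n. C n)"
    using sier unfolding sierpinski_relation_def meager_ideal_def meager_def by simp
  then obtain C :: "real \<Rightarrow> nat \<Rightarrow> real set" where
    "\<forall>y\<in>Y. (\<forall>n. nowhere_dense (C y n)) \<and> {x\<in>Y. r x y} = (\<Union>n. C y n)"
    by (rule bchoice[THEN exE])
  then have C: "\<And>y n. y \<in> Y \<Longrightarrow> nowhere_dense (C y n)"
    "\<And>y. y \<in> Y \<Longrightarrow> {x\<in>Y. r x y} = (\<Union>n. C y n)"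
    by blast+
  obtain \<B> :: "real set set" where \<B>: "countable \<B>" "topological_basis \<B>"
    using ex_countable_basis by blast
  define good where "good n B V E \<longleftrightarrow>
    open V \<and> meager E \<and> (\<forall>y\<in>Y - E. y \<in> V \<longleftrightarrow> B \<inter> C y n = {})" for n B V E
  have "\<exists>V E. good n B V E" for n B
  proof -
    have "{y\<in>Y. B \<inter> C y n = {}} \<subseteq> Y" by simp
    then obtain M where M: "ideal_measurable meager_ideal M" "{y\<in>Y. B \<inter> C y n = {}} = M \<inter> Y"
      using all[unfolded all_subsets_measurable_in_def, rule_format] by meson
    obtain V where V: "open V" "meager ((M - V) \<union> (V - M))"
      using ideal_measurable_meager_imp_almost_open[OF M(1)] unfolding almost_open_def by blast
    have "\<forall>y\<in>Y - ((M - V) \<union> (V - M)). y \<in> V \<longleftrightarrow> B \<inter> C y n = {}"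
      using M(2) by blast
    with V show ?thesis unfolding good_def by blast
  qed
  then obtain V E where "\<And>n B. good n B (V n B) (E n B)"
    by metis
  then have V: "\<And>n B. open (V n B)" and E: "\<And>n B. meager (E n B)"
    and VE: "\<And>n B. \<forall>y\<in>Y - E n B. y \<in> V n B \<longleftrightarrow> B \<inter> C y n = {}"
    by (simp_all add: good_def)
  define Y' where "Y' = Y - (\<Union>n. \<Union>B\<in>\<B>. E n B)"
  have E': "meager (\<Union>n. \<Union>B\<in>\<B>. E n B)"
    by (intro meager_UN E \<B>(1)) auto
  have Y': "Y' \<subseteq> Y" "\<not> meager Y'"
  proof -
    show "Y' \<subseteq> Y" by (auto simp: Y'_def)
    show "\<not> meager Y'"
    proof
      assume "meager Y'"
      then have "meager (Y' \<union> (\<Union>n. \<Union>B\<in>\<B>. E n B))" using E' by (rule meager_Un)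
      then have "meager Y" by (rule meager_subset) (auto simp: Y'_def)
      with Y show False by (simp add: meager_ideal_def)
    qed
  qed
  have VC: "y \<in> V n B \<longleftrightarrow> B \<inter> C y n = {}" if "y \<in> Y'" "B \<in> \<B>" for y n B
    using VE[of n B] that unfolding Y'_def by blast
  define T where "T n x = (\<Union>B\<in>{B\<in>\<B>. x \<in> B}. V n B)" for n x
  define Q where "Q n W = {x. W \<inter> T n x \<noteq> {}}" for n W
  \<comment> \<open>The set \<open>Q n W\<close> is the projection of the part of the \<open>n\<close>-th plane set that lies over \<open>W\<close>;
    the section at a single point \<open>y\<close> of \<open>W \<inter> Y'\<close> already makes it dense.\<close>
  have Q: "nowhere_dense (- Q n W)" if W: "open W" "W \<inter> Y' \<noteq> {}" for n W
  proof -
    have "Q n W = \<Union>{B\<in>\<B>. W \<inter> V n B \<noteq> {}}" by (auto simp: Q_def T_def)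
    then have "open (Q n W)" using topological_basis_open[OF \<B>(2)] by auto
    then have cl: "closure (- Q n W) = - Q n W" by (simp add: closed_Compl)
    have "False" if "P \<noteq> {}" "open P" "P \<subseteq> - Q n W" for P
    proof -
      obtain y where y: "y \<in> W" "y \<in> Y'" using W by blast
      then have "interior (closure (C y n)) = {}"
        using C(1) Y'(1) unfolding nowhere_dense_def by blast
      then have "\<not> P \<subseteq> closure (C y n)"
        using that(1,2) interior_maximal[of P "closure (C y n)"] by auto
      then obtain x where x: "x \<in> P - closure (C y n)" by blast
      moreover have "open (P - closure (C y n))" using that(2) by (simp add: open_Diff)
      ultimately obtain B where B: "B \<in> \<B>" "x \<in> B" "B \<subseteq> P - closure (C y n)"
        using topological_basisE[OF \<B>(2)] by metis
      then have "y \<in> V n B"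
        using VC[OF y(2)] closure_subset[of "C y n"] by blast
      then have "x \<in> Q n W" using B y(1) by (auto simp: Q_def T_def)
      with x that(3) show False by blast
    qed
    then show ?thesis
      unfolding nowhere_dense_def cl by (metis interior_subset open_interior)
  qed
  \<comment> \<open>Countably many windows \<open>W\<close> suffice to detect density near \<open>Y'\<close>.\<close>
  define \<W> where "\<W> = {W\<in>\<B>. W \<inter> Y' \<noteq> {}}"
  have "meager (\<Union>n. \<Union>W\<in>\<W>. - Q n W)"
    using \<B> by (intro meager_UN nowhere_dense_imp_meager Q)
      (auto simp: \<W>_def intro: topological_basis_open)
  then have "\<not> Y' \<subseteq> (\<Union>n. \<Union>W\<in>\<W>. - Q n W)"
    using Y'(2) meager_subset by blast
  then obtain x where "x \<in> Y'" "x \<notin> (\<Union>n. \<Union>W\<in>\<W>. - Q n W)" by blast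
  then have x: "x \<in> Y'" "\<And>n W. W \<in> \<W> \<Longrightarrow> W \<inter> T n x \<noteq> {}"
    by (auto simp: Q_def)
  have T: "nowhere_dense (Y' - T n x)" for n
  proof -
    have "open (T n x)" using V by (auto simp: T_def)
    have False if P: "P \<noteq> {}" "open P" "P \<subseteq> closure (Y' - T n x)" for P
    proof -
      obtain p where "p \<in> P" using P(1) by blast
      then obtain W where W: "W \<in> \<B>" "p \<in> W" "W \<subseteq> P"
        using topological_basisE[OF \<B>(2) P(2)] by metis
      have "open W" using W(1) \<B>(2) topological_basis_open by blast
      have "W \<inter> (Y' - T n x) \<noteq> {}"
        using open_Int_closure_eq_empty[OF \<open>open W\<close>] W P(3) by blast
      then have "W \<in> \<W>" using W(1) by (auto simp: \<W>_def)
      then have "W \<inter> T n x \<noteq> {}" by (rule x(2))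
      then have "(W \<inter> T n x) \<inter> closure (Y' - T n x) \<noteq> {}" using W(3) P(3) by blast
      then have "(W \<inter> T n x) \<inter> (Y' - T n x) \<noteq> {}"
        using open_Int_closure_eq_empty[of "W \<inter> T n x"] \<open>open W\<close> \<open>open (T n x)\<close> by auto
      then show False by blast
    qed
    then show ?thesis
      unfolding nowhere_dense_def by (metis interior_subset open_interior)
  qed
  have "Y' \<subseteq> {y\<in>Y. \<not> r x y} \<union> (\<Union>n. Y' - T n x)"
  proof
    fix y assume y: "y \<in> Y'"
    show "y \<in> {y\<in>Y. \<not> r x y} \<union> (\<Union>n. Y' - T n x)"
    proof (cases "\<forall>n. y \<in> T n x")
      case True
      then have "x \<notin> C y n" for n
        using VC[OF y] by (fastforce simp: T_def)
      then have "\<not> r x y" using C(2)[of y] x(1) y Y'(1) by blast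
      with y Y'(1) show ?thesis by blast
    qed (use y in blast)
  qed
  moreover have "meager ({y\<in>Y. \<not> r x y} \<union> (\<Union>n. Y' - T n x))"
  proof (intro meager_Un meager_UN)
    show "meager {y\<in>Y. \<not> r x y}"
      using sier x(1) Y'(1) unfolding sierpinski_relation_def meager_ideal_def by blast
  qed (auto intro: nowhere_dense_imp_meager T)
  ultimately show False using Y'(2) meager_subset by blast
qed

section \<open>The decomposition theorem\<close>

theorem theorem1p1:
  fixes I :: "real set set"
  assumes "I = null_ideal \<or> I = meager_ideal"
  shows "\<forall>X :: real set. \<exists>X1 X2. X1 \<subseteq> X \<and> X2 \<subseteq> X \<and> X1 \<union> X2 = X \<and> X1 \<inter> X2 = {} \<and>
           full_in I X1 X \<and> full_in I X2 X"
  using assms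
proof
  assume I: "I = null_ideal"
  show ?thesis
    unfolding I by (intro allI null.full_decomposition) (rule no_sierpinski_relation_null)
next
  assume I: "I = meager_ideal"
  show ?thesis
    unfolding I by (intro allI meager.full_decomposition) (rule no_sierpinski_relation_meager)
qed

end
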